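(* Let $\omega$ be a weight function and $\psi(x)=x+1$ for $x\in\mathbb{R}$. Then the composition operator $C_\psi: \mathcal{S}_{\omega}(\mathbb{R})\to \mathcal{S}_{\omega}(\mathbb{R})$, $f\mapsto f\circ\psi$, is $m$-topologizable.
   Context: A weight function is a continuous increasing function $\omega:[0,\infty)\to[0,\infty)$ such that: $(\alpha)$ there is $L\ge 1$ with $\omega(2t)\le L(\omega(t)+1)$ for all $t\ge 0$; $(\beta)$ $\int_0^\infty \frac{\omega(t)}{1+t^2}\,dt<\infty$; $(\gamma)$ $\log(1+t^2)=o(\omega(t))$ as $t\to\infty$; $(\delta)$ $\varphi_\omega(t):=\omega(e^t)$ is convex. The Young conjugate is $\varphi_\omega^*(s):=\sup\{st-\varphi_\omega(t): t\ge 0\}$, $s\ge 0$. The space $\mathcal{S}_\omega(\mathbb{R})$ consists of all $f\in C^\infty(\mathbb{R})$ such that for every $\lambda>0$ $$p_{\omega,\lambda}(f):=\sup_{x\in\mathbb{R}}\sup_{n,q\in\mathbb{N}_0}(1+|x|)^q|f^{(n)}(x)|\exp\left(-\lambda\varphi_\omega^*\left(\tfrac{n+q}{\lambda}\right)\right)<\infty,$$ with the Fréchet topology given by the system of seminorms $\{p_{\omega,\lambda}:\lambda>0\}$. It is known that the seminorms $$q_{\omega,\lambda,\mu}(f):=\sup_{x\in\mathbb{R}}\sup_{n\in\mathbb{N}_0}|f^{(n)}(x)|\exp\left(-\lambda\varphi_\omega^*\left(\tfrac{n}{\lambda}\right)\right)\exp(\mu\,\omega(|x|)),\quad \lambda,\mu>0,$$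 form an equivalent system on $\mathcal{S}_\omega(\mathbb{R})$. A continuous linear operator $T$ on a locally convex Hausdorff space $E$, whose topology is determined by a system of continuous seminorms $cs(E)$ (here $\{p_{\omega,\lambda}:\lambda>0\}$, or equivalently $\{q_{\omega,\lambda,\mu}:\lambda,\mu>0\}$), is $m$-topologizable if for every $p\in cs(E)$ there are $q\in cs(E)$ and $C\ge 1$ with $p(T^kx)\le C^k\,q(x)$ for all $k\in\mathbb{N}$ and $x\in E$. *)

theory Defs
  imports "HOL-Analysis.Analysis" "HOL-Library.Landau_Symbols"
begin

section \<open>Weight functions\<close>

text \<open>A weight function is only meaningful on \<open>[0,\<infinity>)\<close>; the values of \<open>\<omega>\<close> at negative arguments
  are never used. As usual, \<^emph>\<open>increasing\<close> is not meant strictly.\<close>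

definition weight_function :: "(real \<Rightarrow> real) \<Rightarrow> bool" where
  "weight_function \<omega> \<longleftrightarrow>
     continuous_on {0..} \<omega> \<and> mono_on {0..} \<omega> \<and> (\<forall>t\<ge>0. 0 \<le> \<omega> t) \<and>
     (\<exists>L\<ge>1. \<forall>t\<ge>0. \<omega> (2 * t) \<le> L * (\<omega> t + 1)) \<and>
     set_integrable lborel {0..} (\<lambda>t. \<omega> t / (1 + t\<^sup>2)) \<and>
     (\<lambda>t. ln (1 + t\<^sup>2)) \<in> o[at_top](\<omega>) \<and>
     convex_on UNIV (\<lambda>t. \<omega> (exp t))"

text \<open>For a weight function and \<open>s \<ge> 0\<close> the supremum below is finite, by the growth
  condition \<open>ln (1 + t\<^sup>2) = o(\<omega> t)\<close>.\<close>

definition young_conjugate :: "(real \<Rightarrow> real) \<Rightarrow> real \<Rightarrow> real" where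
  "young_conjugate \<omega> s = (SUP t\<in>{0..}. s * t - \<omega> (exp t))"


section \<open>The space \<open>S\<^sub>\<omega>(\<real>)\<close>\<close>

definition nth_derivative :: "nat \<Rightarrow> (real \<Rightarrow> complex) \<Rightarrow> real \<Rightarrow> complex" where
  "nth_derivative n f = ((\<lambda>g x. vector_derivative g (at x)) ^^ n) f"

definition smooth :: "(real \<Rightarrow> complex) \<Rightarrow> bool" where
  "smooth f \<longleftrightarrow> (\<forall>n x. nth_derivative n f differentiable (at x))"

definition p_term ::
    "(real \<Rightarrow> real) \<Rightarrow> real \<Rightarrow> (real \<Rightarrow> complex) \<Rightarrow> real \<times> nat \<times> nat \<Rightarrow> real" where
  "p_term \<omega> \<kappa> f = (\<lambda>(x, n, q). (1 + \<bar>x\<bar>) ^ q * norm (nth_derivative n f x)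
       * exp (- \<kappa> * young_conjugate \<omega> (real (n + q) / \<kappa>)))"

text \<open>The value is the intended one only if the supremum is finite, which is what
  membership in \<open>S_space\<close> demands.\<close>

definition p_seminorm :: "(real \<Rightarrow> real) \<Rightarrow> real \<Rightarrow> (real \<Rightarrow> complex) \<Rightarrow> real" where
  "p_seminorm \<omega> \<kappa> f = (SUP i. p_term \<omega> \<kappa> f i)"

definition S_space :: "(real \<Rightarrow> real) \<Rightarrow> (real \<Rightarrow> complex) set" where
  "S_space \<omega> = {f. smooth f \<and> (\<forall>\<kappa>>0. bdd_above (range (p_term \<omega> \<kappa> f)))}"

definition S_seminorms :: "(real \<Rightarrow> real) \<Rightarrow> ((real \<Rightarrow> complex) \<Rightarrow> real) set" where
  "S_seminorms \<omega> = {p_seminorm \<omega> \<kappa> | \<kappa>. \<kappa> > 0}"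


section \<open>Operators on locally convex function spaces\<close>

text \<open>Spaces of complex-valued functions with pointwise operations, given by a carrier \<open>E\<close>
  and a set \<open>P\<close> of seminorms on \<open>E\<close>.\<close>

definition seminorm_topology ::
    "('a \<Rightarrow> complex) set \<Rightarrow> (('a \<Rightarrow> complex) \<Rightarrow> real) set \<Rightarrow> ('a \<Rightarrow> complex) topology" where
  "seminorm_topology E P = topology_generated_by
     (insert E {{g \<in> E. p (\<lambda>x. g x - f x) < r} | f p r. f \<in> E \<and> p \<in> P \<and> r > 0})"

definition function_subspace :: "('a \<Rightarrow> complex) set \<Rightarrow> bool" where
  "function_subspace E \<longleftrightarrow> (\<lambda>_. 0) \<in> E \<and> (\<forall>f\<in>E. \<forall>g\<in>E. (\<lambda>x. f x + g x) \<in> E) \<and>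
     (\<forall>c. \<forall>f\<in>E. (\<lambda>x. c * f x) \<in> E)"

definition seminorm_on :: "('a \<Rightarrow> complex) set \<Rightarrow> (('a \<Rightarrow> complex) \<Rightarrow> real) \<Rightarrow> bool" where
  "seminorm_on E p \<longleftrightarrow> (\<forall>f\<in>E. 0 \<le> p f) \<and>
     (\<forall>f\<in>E. \<forall>g\<in>E. p (\<lambda>x. f x + g x) \<le> p f + p g) \<and>
     (\<forall>c. \<forall>f\<in>E. p (\<lambda>x. c * f x) = norm c * p f)"

definition locally_convex_Hausdorff ::
    "('a \<Rightarrow> complex) set \<Rightarrow> (('a \<Rightarrow> complex) \<Rightarrow> real) set \<Rightarrow> bool" where
  "locally_convex_Hausdorff E P \<longleftrightarrow> function_subspace E \<and> (\<forall>p\<in>P. seminorm_on E p) \<and>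
     Hausdorff_space (seminorm_topology E P)"

definition continuous_linear_operator ::
    "('a \<Rightarrow> complex) set \<Rightarrow> (('a \<Rightarrow> complex) \<Rightarrow> real) set
      \<Rightarrow> (('a \<Rightarrow> complex) \<Rightarrow> ('a \<Rightarrow> complex)) \<Rightarrow> bool" where
  "continuous_linear_operator E P T \<longleftrightarrow>
     T \<in> E \<rightarrow> E \<and>
     (\<forall>f\<in>E. \<forall>g\<in>E. T (\<lambda>x. f x + g x) = (\<lambda>x. T f x + T g x)) \<and>
     (\<forall>c. \<forall>f\<in>E. T (\<lambda>x. c * f x) = (\<lambda>x. c * T f x)) \<and>
     continuous_map (seminorm_topology E P) (seminorm_topology E P) T"

text \<open>The system \<open>P\<close> plays the role of \<open>cs(E)\<close> and is meant to be directed up to constants;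
  the family \<open>S_seminorms \<omega>\<close> is, since \<open>p_seminorm \<omega> \<kappa>\<close> increases with \<open>\<kappa>\<close>.\<close>

definition m_topologizable ::
    "('a \<Rightarrow> complex) set \<Rightarrow> (('a \<Rightarrow> complex) \<Rightarrow> real) set
      \<Rightarrow> (('a \<Rightarrow> complex) \<Rightarrow> ('a \<Rightarrow> complex)) \<Rightarrow> bool" where
  "m_topologizable E P T \<longleftrightarrow>
     locally_convex_Hausdorff E P \<and> continuous_linear_operator E P T \<and>
     (\<forall>p\<in>P. \<exists>q\<in>P. \<exists>C\<ge>1. \<forall>k\<ge>1. \<forall>f\<in>E. p ((T ^^ k) f) \<le> C ^ k * q f)"

definition composition_operator ::
    "('a \<Rightarrow> 'a) \<Rightarrow> ('a \<Rightarrow> complex) \<Rightarrow> ('a \<Rightarrow> complex)" where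
  "composition_operator \<psi> f = f \<circ> \<psi>"

end

theory Submission
  imports Defs
begin

text \<open>By the doubling condition, \<open>\<omega> (1 + \<bar>x\<bar>) \<le> L (\<omega> (1 + \<bar>x + k\<bar>) + 1) + L (\<omega> k + 1)\<close>, and \<open>\<omega> k\<close>
  grows at most linearly in \<open>k\<close> because \<open>\<omega> t / (1 + t\<^sup>2)\<close> is integrable. So weights of the form
  \<open>exp (\<mu> \<omega> (1 + \<bar>x\<bar>))\<close> change under translation by \<open>k\<close> only by a factor \<open>C\<^sup>k\<close>, at the cost of
  replacing \<open>\<mu>\<close> by \<open>L \<mu>\<close>. Young duality for the convex function \<open>\<omega> \<circ> exp\<close> converts the polynomial
  weights \<open>(1 + \<bar>x\<bar>)\<^sup>q\<close> into such exponential weights and back.\<close>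

section \<open>Topologies generated by seminorms\<close>

lemma function_subspaceD:
  assumes "function_subspace E"
  shows "(\<lambda>_. 0) \<in> E"
    and "f \<in> E \<Longrightarrow> g \<in> E \<Longrightarrow> (\<lambda>x. f x + g x) \<in> E"
    and "f \<in> E \<Longrightarrow> (\<lambda>x. c * f x) \<in> E"
  using assms by (simp_all add: function_subspace_def)

lemma seminorm_onD:
  assumes "seminorm_on E p"
  shows "f \<in> E \<Longrightarrow> 0 \<le> p f"
    and "f \<in> E \<Longrightarrow> g \<in> E \<Longrightarrow> p (\<lambda>x. f x + g x) \<le> p f + p g"
    and "f \<in> E \<Longrightarrow> p (\<lambda>x. c * f x) = norm c * p f"
  using assms by (simp_all add: seminorm_on_def)

lemma function_subspace_diff:
  assumes "function_subspace E" "f \<in> E" "g \<in> E"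
  shows "(\<lambda>x. f x - g x) \<in> E"
  using function_subspaceD(2)[OF assms(1,2) function_subspaceD(3)[OF assms(1,3), of "- 1"]]
  by simp

lemma seminorm_on_diff_commute:
  assumes "function_subspace E" "seminorm_on E p" "f \<in> E" "g \<in> E"
  shows "p (\<lambda>x. f x - g x) = p (\<lambda>x. g x - f x)"
  using seminorm_onD(3)[OF assms(2) function_subspace_diff[OF assms(1,4,3)], of "- 1"]
  by simp

lemma seminorm_on_diff_triangle:
  assumes "function_subspace E" "seminorm_on E p" "f \<in> E" "g \<in> E" "h \<in> E"
  shows "p (\<lambda>x. f x - h x) \<le> p (\<lambda>x. f x - g x) + p (\<lambda>x. g x - h x)"
  using seminorm_onD(2)[OF assms(2) function_subspace_diff[OF assms(1,3,4)]
      function_subspace_diff[OF assms(1,4,5)]]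
  by simp

lemma seminorm_on_zero:
  assumes "function_subspace E" "seminorm_on E p"
  shows "p (\<lambda>_. 0) = 0"
  using seminorm_onD(3)[OF assms(2) function_subspaceD(1)[OF assms(1)], of 0] by simp

lemma topspace_seminorm_topology [simp]: "topspace (seminorm_topology E P) = E"
  unfolding seminorm_topology_def by auto

lemma openin_seminorm_ball:
  assumes "f \<in> E" "p \<in> P" "r > 0"
  shows "openin (seminorm_topology E P) {g \<in> E. p (\<lambda>x. g x - f x) < r}"
  unfolding seminorm_topology_def by (rule topology_generated_by_Basis) (use assms in blast)

text \<open>Two functions at \<open>p\<close>-distance \<open>2 * r > 0\<close> are separated by the
  \<open>p\<close>-balls of radius \<open>r\<close> around them: a common point would violate the
  triangle inequality.\<close>

lemma Hausdorff_seminorm_topology: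
  assumes E: "function_subspace E" and P: "\<And>p. p \<in> P \<Longrightarrow> seminorm_on E p"
    and sep: "\<And>f. f \<in> E \<Longrightarrow> f \<noteq> (\<lambda>_. 0) \<Longrightarrow> \<exists>p\<in>P. p f > 0"
  shows "Hausdorff_space (seminorm_topology E P)"
  unfolding Hausdorff_space_def topspace_seminorm_topology
proof (intro allI impI)
  fix f g assume fg: "f \<in> E \<and> g \<in> E \<and> f \<noteq> g"
  then have "(\<lambda>x. f x - g x) \<noteq> (\<lambda>_. 0)"
    by (auto simp: fun_eq_iff)
  then obtain p where p: "p \<in> P" "p (\<lambda>x. f x - g x) > 0"
    using sep function_subspace_diff[OF E] fg by blast
  define r where "r = p (\<lambda>x. f x - g x) / 2"
  let ?B = "\<lambda>f. {h \<in> E. p (\<lambda>x. h x - f x) < r}"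
  have r: "r > 0" using p r_def by simp
  have "?B f \<inter> ?B g = {}"
  proof (rule ccontr)
    assume "?B f \<inter> ?B g \<noteq> {}"
    then obtain h where h: "h \<in> E" "p (\<lambda>x. h x - f x) < r" "p (\<lambda>x. h x - g x) < r"
      by blast
    have "p (\<lambda>x. f x - g x) \<le> p (\<lambda>x. f x - h x) + p (\<lambda>x. h x - g x)"
      using seminorm_on_diff_triangle[OF E P] p fg h by blast
    moreover have "p (\<lambda>x. f x - h x) = p (\<lambda>x. h x - f x)"
      using seminorm_on_diff_commute[OF E P] p fg h by blast
    ultimately show False using h r_def by simp
  qed
  moreover have "f \<in> ?B f" "g \<in> ?B g"
    using fg r seminorm_on_zero[OF E P[OF p(1)]] by auto
  moreover have "openin (seminorm_topology E P) (?B f)" "openin (seminorm_topology E P) (?B g)"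
    using openin_seminorm_ball fg p r by blast+
  ultimately show "\<exists>U V. openin (seminorm_topology E P) U \<and> openin (seminorm_topology E P) V \<and>
      f \<in> U \<and> g \<in> V \<and> disjnt U V"
    unfolding disjnt_def by blast
qed

text \<open>Continuity is tested on the subbasis: a seminorm estimate places a \<open>q\<close>-ball
  around each point of the preimage of a \<open>p\<close>-ball.\<close>

lemma continuous_map_seminorm_topology:
  assumes E: "function_subspace E" and P: "\<And>p. p \<in> P \<Longrightarrow> seminorm_on E p"
    and TE: "T \<in> E \<rightarrow> E"
    and diff: "\<And>f g. f \<in> E \<Longrightarrow> g \<in> E \<Longrightarrow> T (\<lambda>x. f x - g x) = (\<lambda>x. T f x - T g x)"
    and bound: "\<And>p. p \<in> P \<Longrightarrow> \<exists>q\<in>P. \<exists>C>0. \<forall>f\<in>E. p (T f) \<le> C * q f"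
  shows "continuous_map (seminorm_topology E P) (seminorm_topology E P) T"
proof -
  let ?X = "seminorm_topology E P"
  have ball: "openin ?X (T -` {g \<in> E. p (\<lambda>x. g x - f x) < r} \<inter> E)"
    if f: "f \<in> E" and p: "p \<in> P" and r: "r > 0" for f p r
  proof (subst openin_subopen, intro ballI)
    fix g assume "g \<in> T -` {g \<in> E. p (\<lambda>x. g x - f x) < r} \<inter> E"
    then have g: "g \<in> E" "T g \<in> E" "p (\<lambda>x. T g x - f x) < r" by auto
    obtain q C where q: "q \<in> P" "C > 0" "\<forall>f\<in>E. p (T f) \<le> C * q f"
      using bound[OF p] by blast
    \<comment> \<open>The distance left between \<open>T g\<close> and the boundary of the ball,
      divided by the bound \<open>C\<close> of \<open>T\<close>.\<close>
    define \<epsilon> where "\<epsilon> = (r - p (\<lambda>x. T g x - f x)) / C"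
    have \<epsilon>: "\<epsilon> > 0" using g q \<epsilon>_def by simp
    let ?B = "{h \<in> E. q (\<lambda>x. h x - g x) < \<epsilon>}"
    have "?B \<subseteq> T -` {g \<in> E. p (\<lambda>x. g x - f x) < r} \<inter> E"
    proof
      fix h assume "h \<in> ?B"
      then have h: "h \<in> E" "q (\<lambda>x. h x - g x) < \<epsilon>" by auto
      then have Th: "T h \<in> E" using TE by blast
      have "p (\<lambda>x. T h x - T g x) \<le> C * q (\<lambda>x. h x - g x)"
        using q(3) function_subspace_diff[OF E h(1) g(1)] diff[OF h(1) g(1)] by metis
      also have "\<dots> < C * \<epsilon>" using h q by simp
      also have "C * \<epsilon> = r - p (\<lambda>x. T g x - f x)" using q \<epsilon>_def by simp
      finally have "p (\<lambda>x. T h x - T g x) + p (\<lambda>x. T g x - f x) < r" by simp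
      then have "p (\<lambda>x. T h x - f x) < r"
        using seminorm_on_diff_triangle[OF E P[OF p] Th g(2) f] by simp
      then show "h \<in> T -` {g \<in> E. p (\<lambda>x. g x - f x) < r} \<inter> E"
        using h Th by simp
    qed
    moreover have "g \<in> ?B" using g \<epsilon> seminorm_on_zero[OF E P[OF q(1)]] by simp
    moreover have "openin ?X ?B" using openin_seminorm_ball g q \<epsilon> by blast
    ultimately show "\<exists>U. openin ?X U \<and> g \<in> U \<and> U \<subseteq> T -` {g \<in> E. p (\<lambda>x. g x - f x) < r} \<inter> E"
      by blast
  qed
  have whole: "T -` E \<inter> E = E" using TE by auto
  show ?thesis
    \<comment> \<open>Only the topology of the codomain is unfolded, so that its generating family
      is exposed.\<close>
    apply (subst (2) seminorm_topology_def)
  proof (rule continuous_on_generated_topo, unfold topspace_seminorm_topology)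
    fix U assume "U \<in> insert E {{g \<in> E. p (\<lambda>x. g x - f x) < r} |f p r. f \<in> E \<and> p \<in> P \<and> r > 0}"
    then consider "U = E" | f p r where
      "U = {g \<in> E. p (\<lambda>x. g x - f x) < r}" "f \<in> E" "p \<in> P" "r > 0"
      by blast
    then show "openin ?X (T -` U \<inter> E)"
    proof cases
      case 1
      then show ?thesis using whole openin_topspace[of ?X] by simp
    next
      case 2
      then show ?thesis using ball by simp
    qed
  next
    show "T ` E \<subseteq> \<Union> (insert E {{g \<in> E. p (\<lambda>x. g x - f x) < r} |f p r. f \<in> E \<and> p \<in> P \<and> r > 0})"
      using TE by blast
  qed
qed

section \<open>Iterated derivatives\<close>

lemma nth_derivative_0 [simp]: "nth_derivative 0 f = f"
  by (simp add: nth_derivative_def)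

lemma nth_derivative_Suc:
  "nth_derivative (Suc n) f = (\<lambda>x. vector_derivative (nth_derivative n f) (at x))"
  by (simp add: nth_derivative_def)

lemma smooth_has_vector_derivative:
  assumes "smooth f"
  shows "(nth_derivative n f has_vector_derivative nth_derivative (Suc n) f x) (at x)"
  using assms by (simp add: smooth_def nth_derivative_Suc vector_derivative_works)

lemma nth_derivative_add:
  assumes "smooth f" "smooth g"
  shows "nth_derivative n (\<lambda>x. f x + g x) = (\<lambda>x. nth_derivative n f x + nth_derivative n g x)"
proof (induction n)
  case (Suc n)
  show ?case
  proof
    fix x
    show "nth_derivative (Suc n) (\<lambda>x. f x + g x) x
        = nth_derivative (Suc n) f x + nth_derivative (Suc n) g x"
      by (subst nth_derivative_Suc, unfold Suc.IH)
        (intro vector_derivative_at has_vector_derivative_add smooth_has_vector_derivative assms)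
  qed
qed simp

lemma nth_derivative_mult_left:
  assumes "smooth f"
  shows "nth_derivative n (\<lambda>x. c * f x) = (\<lambda>x. c * nth_derivative n f x)"
proof (induction n)
  case (Suc n)
  show ?case
  proof
    fix x
    show "nth_derivative (Suc n) (\<lambda>x. c * f x) x = c * nth_derivative (Suc n) f x"
      by (subst nth_derivative_Suc, unfold Suc.IH)
        (intro vector_derivative_at has_vector_derivative_mult_right smooth_has_vector_derivative assms)
  qed
qed simp

text \<open>The chain rule gives one direction for every shift; the converse is that direction for
  the shifted function and \<open>- a\<close>.\<close>

lemma has_vector_derivative_shift_iff:
  fixes f :: "real \<Rightarrow> 'a :: real_normed_vector"
  shows "((\<lambda>x. f (x + a)) has_vector_derivative d) (at x) \<longleftrightarrow>
    (f has_vector_derivative d) (at (x + a))"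
proof -
  have "((\<lambda>x. g (x + b)) has_vector_derivative d) (at y)"
    if "(g has_vector_derivative d) (at (y + b))" for g :: "real \<Rightarrow> 'a" and b y
  proof -
    have "((\<lambda>x. x + b) has_vector_derivative 1) (at y)"
      by (auto intro!: derivative_eq_intros)
    from vector_diff_chain_at[OF this that] show ?thesis by (simp add: o_def)
  qed
  from this[of f x a] this[of "\<lambda>x. f (x + a)" "x + a" "- a"] show ?thesis
    by auto
qed

text \<open>By the preceding equivalence, the predicates from which \<open>vector_derivative\<close>
  chooses its value coincide, so the two sides agree even at points without a derivative.\<close>

lemma nth_derivative_shift:
  "nth_derivative n (\<lambda>x. f (x + a)) = (\<lambda>x. nth_derivative n f (x + a))"
  by (induction n)
    (simp_all add: nth_derivative_Suc vector_derivative_def has_vector_derivative_shift_iff)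

lemma smooth_shift:
  assumes "smooth f"
  shows "smooth (\<lambda>x. f (x + a))"
  unfolding smooth_def nth_derivative_shift
proof (intro allI)
  fix n x
  have "((\<lambda>x. nth_derivative n f (x + a)) has_vector_derivative nth_derivative (Suc n) f (x + a)) (at x)"
    using smooth_has_vector_derivative[OF assms] by (simp add: has_vector_derivative_shift_iff)
  then show "(\<lambda>x. nth_derivative n f (x + a)) differentiable at x"
    by (rule differentiableI_vector)
qed

section \<open>The seminorms of \<open>S\<^sub>\<omega>(\<real>)\<close>\<close>

lemma p_term_nonneg: "0 \<le> p_term \<omega> \<kappa> f i"
  by (cases i) (simp add: p_term_def)

lemma p_term_le_p_seminorm:
  assumes "f \<in> S_space \<omega>" "\<kappa> > 0"
  shows "p_term \<omega> \<kappa> f i \<le> p_seminorm \<omega> \<kappa> f"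
  using assms unfolding p_seminorm_def S_space_def by (auto intro: cSUP_upper)

lemma p_seminorm_le:
  assumes "\<And>i. p_term \<omega> \<kappa> f i \<le> C"
  shows "p_seminorm \<omega> \<kappa> f \<le> C"
  unfolding p_seminorm_def by (rule cSUP_least) (use assms in auto)

lemma p_seminorm_nonneg:
  assumes "f \<in> S_space \<omega>" "\<kappa> > 0"
  shows "0 \<le> p_seminorm \<omega> \<kappa> f"
  using p_term_nonneg p_term_le_p_seminorm[OF assms] order_trans by blast

section \<open>Vector space structure and separation of points\<close>

lemma p_term_add_le:
  assumes "smooth f" "smooth g"
  shows "p_term \<omega> \<kappa> (\<lambda>x. f x + g x) i \<le> p_term \<omega> \<kappa> f i + p_term \<omega> \<kappa> g i"
proof (cases i)
  case (fields x n q)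
  have "(1 + \<bar>x\<bar>) ^ q * norm (nth_derivative n f x + nth_derivative n g x)
      * exp (- \<kappa> * young_conjugate \<omega> (real (n + q) / \<kappa>))
    \<le> (1 + \<bar>x\<bar>) ^ q * (norm (nth_derivative n f x) + norm (nth_derivative n g x))
      * exp (- \<kappa> * young_conjugate \<omega> (real (n + q) / \<kappa>))"
    by (intro mult_right_mono mult_left_mono norm_triangle_ineq) auto
  then show ?thesis
    unfolding fields p_term_def nth_derivative_add[OF assms] by (simp add: algebra_simps)
qed

lemma p_term_mult_left:
  assumes "smooth f"
  shows "p_term \<omega> \<kappa> (\<lambda>x. c * f x) i = norm c * p_term \<omega> \<kappa> f i"
  by (cases i) (simp add: p_term_def nth_derivative_mult_left[OF assms] norm_mult)

lemma S_space_memI: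
  assumes "smooth f" "\<And>\<kappa>. \<kappa> > 0 \<Longrightarrow> \<exists>C. \<forall>i. p_term \<omega> \<kappa> f i \<le> C"
  shows "f \<in> S_space \<omega>"
  using assms unfolding S_space_def bdd_above_def by blast

lemma S_space_smooth: "f \<in> S_space \<omega> \<Longrightarrow> smooth f"
  by (simp add: S_space_def)

lemma smooth_add: "smooth f \<Longrightarrow> smooth g \<Longrightarrow> smooth (\<lambda>x. f x + g x)"
  by (simp add: smooth_def nth_derivative_add)

lemma smooth_mult_left: "smooth f \<Longrightarrow> smooth (\<lambda>x. c * f x)"
  by (simp add: smooth_def nth_derivative_mult_left)

lemma smooth_zero: "smooth (\<lambda>_. 0)"
proof -
  have "nth_derivative n (\<lambda>_. 0) = (\<lambda>_. 0)" for n
    by (induction n) (simp_all add: nth_derivative_Suc)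
  then show ?thesis by (simp add: smooth_def)
qed

lemma function_subspace_S_space: "function_subspace (S_space \<omega>)"
  unfolding function_subspace_def
proof (intro conjI ballI allI)
  show "(\<lambda>_. 0) \<in> S_space \<omega>"
  proof (rule S_space_memI[OF smooth_zero])
    fix \<kappa> :: real
    have "p_term \<omega> \<kappa> (\<lambda>_. 0) i \<le> 0" for i
      using p_term_mult_left[OF smooth_zero, of \<omega> \<kappa> 0 i] by simp
    then show "\<exists>C. \<forall>i. p_term \<omega> \<kappa> (\<lambda>_. 0) i \<le> C" by blast
  qed
next
  fix f g assume fg: "f \<in> S_space \<omega>" "g \<in> S_space \<omega>"
  note smooth = fg[THEN S_space_smooth]
  show "(\<lambda>x. f x + g x) \<in> S_space \<omega>"
  proof (rule S_space_memI[OF smooth_add[OF smooth]])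
    fix \<kappa> :: real assume "\<kappa> > 0"
    then have "p_term \<omega> \<kappa> (\<lambda>x. f x + g x) i \<le> p_seminorm \<omega> \<kappa> f + p_seminorm \<omega> \<kappa> g" for i
      using p_term_add_le[OF smooth, of \<omega> \<kappa> i] p_term_le_p_seminorm[OF fg(1), of \<kappa> i]
        p_term_le_p_seminorm[OF fg(2), of \<kappa> i] by linarith
    then show "\<exists>C. \<forall>i. p_term \<omega> \<kappa> (\<lambda>x. f x + g x) i \<le> C" by blast
  qed
next
  fix c f assume f: "f \<in> S_space \<omega>"
  note smooth = f[THEN S_space_smooth]
  show "(\<lambda>x. c * f x) \<in> S_space \<omega>"
  proof (rule S_space_memI[OF smooth_mult_left[OF smooth]])
    fix \<kappa> :: real assume "\<kappa> > 0"
    then have "p_term \<omega> \<kappa> (\<lambda>x. c * f x) i \<le> norm c * p_seminorm \<omega> \<kappa> f" for i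
      using p_term_le_p_seminorm[OF f, of \<kappa> i]
      by (simp add: p_term_mult_left[OF smooth] mult_left_mono)
    then show "\<exists>C. \<forall>i. p_term \<omega> \<kappa> (\<lambda>x. c * f x) i \<le> C" by blast
  qed
qed

lemma seminorm_on_p_seminorm:
  assumes \<kappa>: "\<kappa> > 0"
  shows "seminorm_on (S_space \<omega>) (p_seminorm \<omega> \<kappa>)"
  unfolding seminorm_on_def
proof (intro conjI ballI allI)
  fix f assume f: "f \<in> S_space \<omega>"
  show "0 \<le> p_seminorm \<omega> \<kappa> f" using p_seminorm_nonneg[OF f \<kappa>] .
  show "p_seminorm \<omega> \<kappa> (\<lambda>x. f x + g x) \<le> p_seminorm \<omega> \<kappa> f + p_seminorm \<omega> \<kappa> g"
    if g: "g \<in> S_space \<omega>" for g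
    by (rule p_seminorm_le, rule order_trans[OF p_term_add_le])
      (use f g \<kappa> in \<open>auto intro!: S_space_smooth add_mono p_term_le_p_seminorm\<close>)
  have le: "p_seminorm \<omega> \<kappa> (\<lambda>x. c * f x) \<le> norm c * p_seminorm \<omega> \<kappa> f"
    if "f \<in> S_space \<omega>" for c f
    by (rule p_seminorm_le, subst p_term_mult_left)
      (use that \<kappa> in \<open>auto intro!: S_space_smooth mult_left_mono p_term_le_p_seminorm\<close>)
  show "p_seminorm \<omega> \<kappa> (\<lambda>x. c * f x) = norm c * p_seminorm \<omega> \<kappa> f" for c
  proof (cases "c = 0")
    case True
    have "(\<lambda>x. c * f x) \<in> S_space \<omega>"
      by (rule function_subspaceD(3)[OF function_subspace_S_space f])
    then show ?thesis
      using le[OF f, of c] p_seminorm_nonneg[OF _ \<kappa>, of "\<lambda>x. c * f x" \<omega>] True by simp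
  next
    case False
    have "(\<lambda>x. c * f x) \<in> S_space \<omega>"
      by (rule function_subspaceD(3)[OF function_subspace_S_space f])
    \<comment> \<open>The reverse inequality is \<open>le\<close> for the function
      \<open>c * f\<close> and the scalar \<open>inverse c\<close>.\<close>
    from le[OF this, of "inverse c"]
    have "p_seminorm \<omega> \<kappa> f \<le> inverse (norm c) * p_seminorm \<omega> \<kappa> (\<lambda>x. c * f x)"
      using False by (simp add: mult.assoc[symmetric] norm_inverse)
    then have "norm c * p_seminorm \<omega> \<kappa> f \<le> p_seminorm \<omega> \<kappa> (\<lambda>x. c * f x)"
      using False by (simp add: field_simps)
    then show ?thesis using le[OF f, of c] by simp
  qed
qed

lemma p_seminorm_pos:
  assumes f: "f \<in> S_space \<omega>" and "f \<noteq> (\<lambda>_. 0)" and \<kappa>: "\<kappa> > 0"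
  shows "p_seminorm \<omega> \<kappa> f > 0"
proof -
  from assms obtain x where x: "f x \<noteq> 0" by auto
  then have "0 < p_term \<omega> \<kappa> f (x, 0, 0)"
    by (simp add: p_term_def)
  also have "\<dots> \<le> p_seminorm \<omega> \<kappa> f"
    by (rule p_term_le_p_seminorm[OF f \<kappa>])
  finally show ?thesis .
qed

lemma locally_convex_Hausdorff_S_space: "locally_convex_Hausdorff (S_space \<omega>) (S_seminorms \<omega>)"
  unfolding locally_convex_Hausdorff_def
proof (intro conjI ballI)
  show sn: "seminorm_on (S_space \<omega>) p" if "p \<in> S_seminorms \<omega>" for p
    using that seminorm_on_p_seminorm unfolding S_seminorms_def by blast
  show "Hausdorff_space (seminorm_topology (S_space \<omega>) (S_seminorms \<omega>))"
  proof (rule Hausdorff_seminorm_topology[OF function_subspace_S_space sn])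
    fix f assume "f \<in> S_space \<omega>" "f \<noteq> (\<lambda>_. 0)"
    \<comment> \<open>Each \<open>p_seminorm\<close> with positive parameter is a norm, so a single
      one separates points.\<close>
    then have "p_seminorm \<omega> 1 f > 0" by (rule p_seminorm_pos) simp
    then show "\<exists>p\<in>S_seminorms \<omega>. p f > 0"
      unfolding S_seminorms_def using zero_less_one by blast
  qed
qed (rule function_subspace_S_space)

section \<open>Weight functions and Young conjugates\<close>

lemma weight_function_nonneg: "weight_function \<omega> \<Longrightarrow> 0 \<le> t \<Longrightarrow> 0 \<le> \<omega> t"
  by (simp add: weight_function_def)

lemma weight_function_mono: "weight_function \<omega> \<Longrightarrow> 0 \<le> s \<Longrightarrow> s \<le> t \<Longrightarrow> \<omega> s \<le> \<omega> t"
  by (auto simp: weight_function_def mono_on_def)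

text \<open>Condition (\<gamma>) in the variable \<open>u = ln t\<close>, using
  \<open>u <= ln (1 + (exp u)^2)\<close>. It makes the supremum in the Young conjugate
  finite.\<close>

lemma weight_function_exp_dominates_linear:
  assumes \<omega>: "weight_function \<omega>" and a: "a > 0"
  obtains M where "M \<ge> 0" "\<And>u. u \<ge> 0 \<Longrightarrow> a * u \<le> \<omega> (exp u) + M"
proof -
  have "(\<lambda>t. ln (1 + t\<^sup>2)) \<in> o[at_top](\<omega>)"
    using \<omega> by (simp add: weight_function_def)
  then have "\<forall>\<^sub>F t in at_top. norm (ln (1 + t\<^sup>2)) \<le> (1 / a) * norm (\<omega> t)"
    using a by (intro landau_o.smallD) auto
  then obtain N where N: "\<And>t. t \<ge> N \<Longrightarrow> norm (ln (1 + t\<^sup>2)) \<le> (1 / a) * norm (\<omega> t)"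
    unfolding eventually_at_top_linorder by blast
  show ?thesis
  proof
    \<comment> \<open>The constant covers the range \<open>exp u < N\<close>, where
      \<open>u <= exp u\<close>; beyond \<open>N\<close> the weight alone dominates.\<close>
    show "0 \<le> a * \<bar>N\<bar>" using a by simp
    fix u :: real assume u: "u \<ge> 0"
    show "a * u \<le> \<omega> (exp u) + a * \<bar>N\<bar>"
    proof (cases "exp u \<ge> N")
      case True
      have "u = ln (exp u)" by simp
      also have "\<dots> \<le> ln (1 + (exp u)\<^sup>2)"
      proof (subst ln_le_cancel_iff)
        have "exp u * 1 \<le> exp u * exp u" using u by (intro mult_left_mono) auto
        then show "exp u \<le> 1 + (exp u)\<^sup>2" unfolding power2_eq_square by linarith
      qed (auto intro: add_pos_nonneg)
      also have "\<dots> \<le> (1 / a) * \<omega> (exp u)"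
        using N[OF True] weight_function_nonneg[OF \<omega>, of "exp u"] by simp
      finally have "a * u \<le> \<omega> (exp u)" using a by (simp add: field_simps)
      then show ?thesis using a by (simp add: add_increasing2)
    next
      case False
      have "u \<le> exp u" using exp_ge_add_one_self[of u] by linarith
      then have "a * u \<le> a * \<bar>N\<bar>" using False a by (intro mult_left_mono) auto
      then show ?thesis using weight_function_nonneg[OF \<omega>, of "exp u"] by simp
    qed
  qed
qed

section \<open>Estimates for the Young conjugate\<close>

lemma young_conjugate_upper:
  assumes \<omega>: "weight_function \<omega>" and "s \<ge> 0" "t \<ge> 0"
  shows "s * t - \<omega> (exp t) \<le> young_conjugate \<omega> s"
  unfolding young_conjugate_def
proof (rule cSUP_upper)
  \<comment> \<open>The slope \<open>s + 1\<close> is positive even for \<open>s = 0\<close>, and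
    its surplus \<open>t\<close> is nonnegative.\<close>
  obtain M where M: "M \<ge> 0" "\<And>u. u \<ge> 0 \<Longrightarrow> (s + 1) * u \<le> \<omega> (exp u) + M"
    using weight_function_exp_dominates_linear[OF \<omega>, of "s + 1"] assms by auto
  show "bdd_above ((\<lambda>t. s * t - \<omega> (exp t)) ` {0..})"
  proof (rule bdd_aboveI2)
    fix t :: real assume "t \<in> {0..}"
    then show "s * t - \<omega> (exp t) \<le> M" using M(2)[of t] by (simp add: algebra_simps)
  qed
qed (use assms in auto)

lemma young_conjugate_le:
  assumes "\<And>t. t \<ge> 0 \<Longrightarrow> s * t - \<omega> (exp t) \<le> C"
  shows "young_conjugate \<omega> s \<le> C"
  unfolding young_conjugate_def by (rule cSUP_least) (use assms in auto)

lemma young_conjugate_mono: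
  assumes \<omega>: "weight_function \<omega>" and "0 \<le> s" "s \<le> t"
  shows "young_conjugate \<omega> s \<le> young_conjugate \<omega> t"
proof (rule young_conjugate_le)
  fix u :: real assume u: "u \<ge> 0"
  have "s * u \<le> t * u" using assms u by (intro mult_right_mono)
  then show "s * u - \<omega> (exp u) \<le> young_conjugate \<omega> t"
    using young_conjugate_upper[OF \<omega>, of t u] assms u by simp
qed

text \<open>Convexity of the conjugate combined with a nonpositive value at 0. It follows directly
  from \<open>\<omega> \<ge> 0\<close>: subtracting \<open>\<theta> * \<omega>\<close> instead of
  \<open>\<omega>\<close> only raises the expression.\<close>

lemma young_conjugate_scale_le:
  assumes \<omega>: "weight_function \<omega>" and \<theta>: "0 \<le> \<theta>" "\<theta> \<le> 1" and "0 \<le> s"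
  shows "young_conjugate \<omega> (\<theta> * s) \<le> \<theta> * young_conjugate \<omega> s"
proof (rule young_conjugate_le)
  fix u :: real assume u: "u \<ge> 0"
  have "\<theta> * (s * u - \<omega> (exp u)) \<le> \<theta> * young_conjugate \<omega> s"
    using young_conjugate_upper[OF \<omega>, of s u] assms u by (intro mult_left_mono) auto
  moreover have "\<theta> * \<omega> (exp u) \<le> \<omega> (exp u)"
    using weight_function_nonneg[OF \<omega>, of "exp u"] \<theta> by (simp add: mult_left_le_one_le)
  ultimately show "\<theta> * s * u - \<omega> (exp u) \<le> \<theta> * young_conjugate \<omega> s"
    by (simp add: algebra_simps)
qed

text \<open>Both \<open>s\<close> and \<open>t\<close> are fractions of \<open>s + t\<close> that
  add up to 1, so the scaling inequality applies to each.\<close>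

lemma young_conjugate_superadditive:
  assumes \<omega>: "weight_function \<omega>" and "0 \<le> s" "0 \<le> t"
  shows "young_conjugate \<omega> s + young_conjugate \<omega> t \<le> young_conjugate \<omega> (s + t)"
proof (cases "s + t = 0")
  case True
  then have "s = 0" "t = 0" using assms by auto
  moreover have "young_conjugate \<omega> 0 \<le> 0"
    using young_conjugate_scale_le[OF \<omega>, of 0 0] by simp
  ultimately show ?thesis by simp
next
  case False
  then have pos: "s + t > 0" using assms by simp
  define r where "r = s / (s + t)"
  have r: "0 \<le> r" "r \<le> 1" "r * (s + t) = s" "(1 - r) * (s + t) = t"
    using pos assms by (auto simp: r_def field_simps)
  have "young_conjugate \<omega> s \<le> r * young_conjugate \<omega> (s + t)"
    using young_conjugate_scale_le[OF \<omega>, of r "s + t"] r pos by simp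
  moreover have "young_conjugate \<omega> t \<le> (1 - r) * young_conjugate \<omega> (s + t)"
    using young_conjugate_scale_le[OF \<omega>, of "1 - r" "s + t"] r pos by simp
  ultimately show ?thesis by (simp add: algebra_simps)
qed

text \<open>A supremum of functions affine in \<open>s\<close> is convex.\<close>

lemma young_conjugate_midpoint:
  assumes \<omega>: "weight_function \<omega>" and "0 \<le> s" "0 \<le> t"
  shows "2 * young_conjugate \<omega> ((s + t) / 2) \<le> young_conjugate \<omega> s + young_conjugate \<omega> t"
proof -
  have "young_conjugate \<omega> ((s + t) / 2) \<le> (young_conjugate \<omega> s + young_conjugate \<omega> t) / 2"
  proof (rule young_conjugate_le)
    fix u :: real assume u: "u \<ge> 0"
    show "(s + t) / 2 * u - \<omega> (exp u) \<le> (young_conjugate \<omega> s + young_conjugate \<omega> t) / 2"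
      using young_conjugate_upper[OF \<omega> assms(2) u] young_conjugate_upper[OF \<omega> assms(3) u]
      by (simp add: field_simps)
  qed
  then show ?thesis by simp
qed

text \<open>The scaling inequality with the factor \<open>\<kappa> / \<mu>\<close>.\<close>

lemma young_conjugate_dilation_antimono:
  assumes \<omega>: "weight_function \<omega>" and \<kappa>: "0 < \<kappa>" "\<kappa> \<le> \<mu>" and a: "0 \<le> a"
  shows "\<mu> * young_conjugate \<omega> (a / \<mu>) \<le> \<kappa> * young_conjugate \<omega> (a / \<kappa>)"
proof -
  have "young_conjugate \<omega> ((\<kappa> / \<mu>) * (a / \<kappa>)) \<le> (\<kappa> / \<mu>) * young_conjugate \<omega> (a / \<kappa>)"
    using \<kappa> a by (intro young_conjugate_scale_le[OF \<omega>]) auto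
  then show ?thesis using \<kappa> by (simp add: field_simps)
qed

text \<open>The supremum in the biconjugate \<open>\<phi>\<^sup>*\<^sup>*\<close> of \<open>\<phi> = \<omega> \<circ> exp\<close> at \<open>u\<close> is attained at a subgradient
  \<open>s\<close>; rounding \<open>\<mu> s\<close> down to an integer loses at most \<open>u\<close>.\<close>

lemma young_biconjugate_nat:
  assumes \<omega>: "weight_function \<omega>" and u: "u \<ge> 0" and \<mu>: "\<mu> > 0"
  obtains q :: nat where
    "\<mu> * \<omega> (exp u) - u \<le> real q * u - \<mu> * young_conjugate \<omega> (real q / \<mu>)"
proof -
  \<comment> \<open>The right derivative of the convex function at \<open>u\<close>, which is a
    subgradient there.\<close>
  define s where "s = (INF t\<in>{u<..} \<inter> UNIV. (\<omega> (exp u) - \<omega> (exp t)) / (u - t))"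
  have "convex_on UNIV (\<lambda>t. \<omega> (exp t))" using \<omega> by (simp add: weight_function_def)
  then have sub: "\<omega> (exp u) + s * (t - u) \<le> \<omega> (exp t)" for t
    unfolding s_def by (intro convex_le_Inf_differential) auto
  have "\<omega> (exp (u - 1)) \<le> \<omega> (exp u)"
    by (rule weight_function_mono[OF \<omega>]) auto
  \<comment> \<open>Monotonicity of the weight makes the subgradient nonnegative: the supporting
    line is tested at \<open>u - 1\<close>.\<close>
  then have s: "s \<ge> 0" using sub[of "u - 1"] by simp
  define q where "q = nat \<lfloor>\<mu> * s\<rfloor>"
  have q: "real q \<le> \<mu> * s" "\<mu> * s \<le> real q + 1"
    using s \<mu> by (auto simp: q_def intro: order.strict_implies_order)
  have "young_conjugate \<omega> (real q / \<mu>) \<le> young_conjugate \<omega> s"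
    using q \<mu> by (intro young_conjugate_mono[OF \<omega>]) (auto simp: field_simps)
  also have "\<dots> \<le> s * u - \<omega> (exp u)"
  proof (rule young_conjugate_le)
    show "s * t - \<omega> (exp t) \<le> s * u - \<omega> (exp u)" for t
      using sub[of t] by (simp add: algebra_simps)
  qed
  finally have "\<mu> * young_conjugate \<omega> (real q / \<mu>) \<le> \<mu> * (s * u - \<omega> (exp u))"
    using \<mu> by simp
  moreover have "\<mu> * s * u \<le> (real q + 1) * u"
    using q u by (intro mult_right_mono) auto
  ultimately have "\<mu> * \<omega> (exp u) - u \<le> real q * u - \<mu> * young_conjugate \<omega> (real q / \<mu>)"
    by (simp add: algebra_simps)
  then show ?thesis by (rule that)
qed

section \<open>Growth of the weight\<close>

text \<open>By monotonicity, the integral of \<open>\<omega> s / (1 + s^2)\<close> over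
  \<open>[t, 2 * t]\<close> alone is at least \<open>t * \<omega> t / (1 + (2 * t)^2)\<close>, while
  the whole integral is finite.\<close>

lemma weight_function_linear_bound:
  assumes \<omega>: "weight_function \<omega>"
  obtains B where "B \<ge> 0" "\<And>t. t \<ge> 1 \<Longrightarrow> \<omega> t \<le> B * t"
proof -
  define J where "J = (LINT t:{0..}|lborel. \<omega> t / (1 + t\<^sup>2))"
  have int: "set_integrable lborel {0..} (\<lambda>t. \<omega> t / (1 + t\<^sup>2))"
    using \<omega> by (simp add: weight_function_def)
  have J: "J \<ge> 0"
    unfolding J_def set_lebesgue_integral_def
    by (rule integral_nonneg_AE) (auto simp: indicator_def weight_function_nonneg[OF \<omega>])
  have "\<omega> t \<le> (5 * J) * t" if t: "t \<ge> 1" for t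
  proof -
    \<comment> \<open>A lower bound of the integrand on \<open>[t, 2 * t]\<close>: least numerator
      over largest denominator.\<close>
    define c where "c = \<omega> t / (1 + (2 * t)\<^sup>2)"
    have "(LINT s|lborel. indicator {t..2 * t} s *\<^sub>R c) \<le> J"
      unfolding J_def set_lebesgue_integral_def
    proof (rule integral_mono)
      show "integrable lborel (\<lambda>s. indicator {t..2 * t} s *\<^sub>R c)"
        by (intro integrable_scaleR_left integrable_real_indicator) (use t in auto)
      show "integrable lborel (\<lambda>s. indicator {0..} s *\<^sub>R (\<omega> s / (1 + s\<^sup>2)))"
        using int by (simp add: set_integrable_def)
      fix s :: real
      have "c \<le> \<omega> s / (1 + s\<^sup>2)" if s: "s \<in> {t..2 * t}"
        unfolding c_def
      proof (rule frac_le)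
        show "0 \<le> \<omega> s" "\<omega> t \<le> \<omega> s"
          using s t weight_function_nonneg[OF \<omega>, of s] weight_function_mono[OF \<omega>, of t s] by auto
        show "0 < 1 + s\<^sup>2" by (simp add: add_pos_nonneg)
        show "1 + s\<^sup>2 \<le> 1 + (2 * t)\<^sup>2" using s t by (intro add_left_mono power_mono) auto
      qed
      moreover have "0 \<le> \<omega> s / (1 + s\<^sup>2)" if "s \<ge> 0"
        using that weight_function_nonneg[OF \<omega>] by simp
      ultimately show "indicator {t..2 * t} s *\<^sub>R c \<le> indicator {0..} s *\<^sub>R (\<omega> s / (1 + s\<^sup>2))"
        using t by (auto simp: indicator_def)
    qed
    moreover have "(LINT s|lborel. indicator {t..2 * t} s *\<^sub>R c) = t * c"
      using t by simp
    moreover have "0 < 1 + (2 * t)\<^sup>2" by (rule add_pos_nonneg) auto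
    ultimately have "t * \<omega> t \<le> J * (1 + (2 * t)\<^sup>2)"
      using t by (simp add: c_def pos_divide_le_eq)
    \<comment> \<open>The factor 5 arises from \<open>1 + 4 * t^2\<close> and
      \<open>1 <= t^2\<close>.\<close>
    also have "\<dots> \<le> J * (5 * t\<^sup>2)"
      using J t by (intro mult_left_mono) (auto simp: power_mult_distrib)
    finally have "t * \<omega> t \<le> t * (5 * J * t)" by (simp add: power2_eq_square algebra_simps)
    then show ?thesis using t by (simp add: mult_le_cancel_left_pos)
  qed
  then show ?thesis using that[of "5 * J"] J by simp
qed

text \<open>Doubling applied to \<open>s + t <= 2 * max s t\<close>; nonnegativity then replaces the
  maximum of the weights by their sum.\<close>

lemma weight_function_add_le:
  assumes \<omega>: "weight_function \<omega>"
    and L: "L \<ge> 0" "\<And>t. t \<ge> 0 \<Longrightarrow> \<omega> (2 * t) \<le> L * (\<omega> t + 1)"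
    and st: "0 \<le> s" "0 \<le> t"
  shows "\<omega> (s + t) \<le> L * \<omega> s + L * \<omega> t + 2 * L"
proof -
  have "\<omega> (s + t) \<le> \<omega> (2 * max s t)"
    using st by (intro weight_function_mono[OF \<omega>]) auto
  also have "\<dots> \<le> L * (\<omega> (max s t) + 1)" using L(2)[of "max s t"] st by simp
  also have "\<dots> \<le> L * (\<omega> s + \<omega> t + 2)"
    using weight_function_nonneg[OF \<omega>, of s] weight_function_nonneg[OF \<omega>, of t] st L
    by (intro mult_left_mono) (auto simp: max_def)
  finally show ?thesis by (simp add: algebra_simps)
qed

section \<open>Translations\<close>

text \<open>The term of the translate at \<open>x\<close> is compared with a term of
  \<open>f\<close> at \<open>x + k\<close> of the same order \<open>n\<close> but with another power
  \<open>r\<close>. The constants depend only on \<open>\<omega>\<close> and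
  \<open>\<kappa>\<close>. Bounding single terms serves both membership in \<open>S_space\<close>
  and the seminorm estimate.\<close>

lemma p_term_translation_bound:
  assumes \<omega>: "weight_function \<omega>" and \<kappa>: "\<kappa> > 0"
  obtains \<mu> C where "\<mu> > 0" "C \<ge> 1"
    "\<And>k f i. k \<ge> 1 \<Longrightarrow> f \<in> S_space \<omega> \<Longrightarrow>
      p_term \<omega> \<kappa> (\<lambda>x. f (x + real k)) i \<le> C ^ k * p_seminorm \<omega> \<mu> f"
proof -
  let ?Y = "young_conjugate \<omega>"
  obtain L where L: "L \<ge> 1" "\<And>t. t \<ge> 0 \<Longrightarrow> \<omega> (2 * t) \<le> L * (\<omega> t + 1)"
    using \<omega> by (auto simp: weight_function_def)
  obtain B where B: "B \<ge> 0" "\<And>t. t \<ge> 1 \<Longrightarrow> \<omega> t \<le> B * t"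
    using weight_function_linear_bound[OF \<omega>] by blast
  obtain M where M: "M \<ge> 0" "\<And>u. u \<ge> 0 \<Longrightarrow> 1 * u \<le> \<omega> (exp u) + M"
    by (rule weight_function_exp_dominates_linear[OF \<omega>, of 1]) auto
  \<comment> \<open>The part \<open>\<kappa> * L\<close> carries the weight moved by doubling; the
    extra 1 pays for the loss \<open>u\<close> in \<open>young_biconjugate_nat\<close>, through
    \<open>u <= \<omega> (exp u) + M\<close>.\<close>
  define \<nu> where "\<nu> = 1 + \<kappa> * L"
  have "\<kappa> * 1 \<le> \<kappa> * L" using \<kappa> L by (intro mult_left_mono) auto
  then have \<nu>: "\<nu> > 0" "\<kappa> \<le> \<nu>" unfolding \<nu>_def using \<kappa> by linarith+
  \<comment> \<open>\<open>A\<close> collects the constants of doubling and of absorbing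
    \<open>u\<close>; \<open>D\<close> is the growth rate in \<open>k\<close>.\<close>
  define A where "A = 2 * \<kappa> * L + M"
  define D where "D = \<kappa> * L * B"
  have AD: "A \<ge> 0" "D \<ge> 0" using \<kappa> L M B by (auto simp: A_def D_def)
  show ?thesis
  proof (rule that)
    \<comment> \<open>The witness for \<open>\<mu>\<close> is \<open>2 * \<nu>\<close>, since
      midpoint convexity splits the conjugate at \<open>(n + r) / (2 * \<nu>)\<close> into
      conjugates at \<open>n / \<nu>\<close> and \<open>r / \<nu>\<close>.\<close>
    show "2 * \<nu> > 0" using \<nu> by simp
    show "exp (A + D) \<ge> 1" using AD by simp
    fix k :: nat and f and i :: "real \<times> nat \<times> nat"
    assume k: "k \<ge> 1" and f: "f \<in> S_space \<omega>"
    obtain x n q where i: "i = (x, n, q)" by (cases i)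
    define y where "y = x + real k"
    define \<tau> where "\<tau> = ln (1 + \<bar>x\<bar>)"
    define u where "u = ln (1 + \<bar>y\<bar>)"
    have \<tau>: "\<tau> \<ge> 0" "exp \<tau> = 1 + \<bar>x\<bar>" and u: "u \<ge> 0" "exp u = 1 + \<bar>y\<bar>"
      by (simp_all add: \<tau>_def u_def add_pos_nonneg)
    \<comment> \<open>The power \<open>r\<close> depends on \<open>y\<close>, not on
      \<open>q\<close>; it makes the polynomial weight at \<open>y\<close> nearly as large as
      \<open>exp (\<nu> * \<omega> (1 + \<bar>y\<bar>))\<close>.\<close>
    obtain r :: nat where r: "\<nu> * \<omega> (exp u) - u \<le> real r * u - \<nu> * ?Y (real r / \<nu>)"
      by (rule young_biconjugate_nat[OF \<omega> u(1) \<nu>(1)])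
    let ?N = "norm (nth_derivative n f y)" and ?P = "p_seminorm \<omega> (2 * \<nu>) f"
    define e where "e = 2 * \<nu> * ?Y (real (n + r) / (2 * \<nu>))"
    have "exp (real r * u) * ?N * exp (- e) \<le> ?P"
      using p_term_le_p_seminorm[OF f, of "2 * \<nu>" "(y, n, r)"] \<nu>
      by (simp add: p_term_def e_def exp_of_nat_mult u)
    then have "(exp (real r * u) * ?N * exp (- e)) * exp (e - real r * u) \<le> ?P * exp (e - real r * u)"
      by (intro mult_right_mono) auto
    then have N: "?N \<le> ?P * exp (e - real r * u)"
      by (simp add: exp_diff exp_minus field_simps)
    \<comment> \<open>In the sum of the numbered inequalities and \<open>r\<close>, the conjugates
      at \<open>q\<close>, \<open>n\<close> and \<open>r\<close> cancel, and the remaining weights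
      at \<open>\<tau>\<close> and \<open>u\<close> are compared by 5 and 6.\<close>
    have exponent: "real q * \<tau> - \<kappa> * ?Y (real (n + q) / \<kappa>) + (e - real r * u) \<le> A + D * real k"
    proof -
      have "\<kappa> * (real q / \<kappa> * \<tau> - \<omega> (exp \<tau>)) \<le> \<kappa> * ?Y (real q / \<kappa>)"
        using young_conjugate_upper[OF \<omega>, of "real q / \<kappa>" \<tau>] \<kappa> \<tau> by (intro mult_left_mono) auto
      then have 1: "real q * \<tau> - \<kappa> * \<omega> (exp \<tau>) \<le> \<kappa> * ?Y (real q / \<kappa>)"
        using \<kappa> by (simp add: right_diff_distrib)
      have "\<kappa> * (?Y (real n / \<kappa>) + ?Y (real q / \<kappa>)) \<le> \<kappa> * ?Y (real n / \<kappa> + real q / \<kappa>)"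
        using young_conjugate_superadditive[OF \<omega>, of "real n / \<kappa>" "real q / \<kappa>"] \<kappa>
        by (intro mult_left_mono) auto
      then have 2: "\<kappa> * ?Y (real n / \<kappa>) + \<kappa> * ?Y (real q / \<kappa>) \<le> \<kappa> * ?Y (real (n + q) / \<kappa>)"
        by (simp add: add_divide_distrib distrib_left)
      have "\<nu> * (2 * ?Y ((real n / \<nu> + real r / \<nu>) / 2)) \<le> \<nu> * (?Y (real n / \<nu>) + ?Y (real r / \<nu>))"
        using young_conjugate_midpoint[OF \<omega>, of "real n / \<nu>" "real r / \<nu>"] \<nu>
        by (intro mult_left_mono) auto
      moreover have "(real n / \<nu> + real r / \<nu>) / 2 = real (n + r) / (2 * \<nu>)"
        using \<nu> by (simp add: field_simps)
      ultimately have 3: "e \<le> \<nu> * ?Y (real n / \<nu>) + \<nu> * ?Y (real r / \<nu>)"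
        by (simp add: e_def distrib_left)
      have 4: "\<nu> * ?Y (real n / \<nu>) \<le> \<kappa> * ?Y (real n / \<kappa>)"
        using \<kappa> \<nu> by (intro young_conjugate_dilation_antimono[OF \<omega>]) auto
      have 5: "\<kappa> * L * \<omega> (exp u) \<le> \<nu> * \<omega> (exp u) - u + M"
        using M(2)[OF u(1)] by (simp add: \<nu>_def algebra_simps)
      \<comment> \<open>Here \<open>1 + \<bar>x\<bar> \<le> 1 + \<bar>y\<bar> + k\<close>, and the
        linear bound on the weight at \<open>k\<close> turns the shift into a cost linear in
        \<open>k\<close>.\<close>
      have "\<omega> (exp \<tau>) \<le> \<omega> (exp u + real k)"
        by (rule weight_function_mono[OF \<omega>]) (auto simp: \<tau> u y_def)
      also have "\<dots> \<le> L * \<omega> (exp u) + L * \<omega> (real k) + 2 * L"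
        using L by (intro weight_function_add_le[OF \<omega>]) auto
      also have "\<dots> \<le> L * \<omega> (exp u) + L * (B * real k) + 2 * L"
        using B(2)[of "real k"] k L by (auto intro!: mult_left_mono)
      finally have "\<kappa> * \<omega> (exp \<tau>) \<le> \<kappa> * (L * \<omega> (exp u) + L * (B * real k) + 2 * L)"
        using \<kappa> by simp
      then have 6: "\<kappa> * \<omega> (exp \<tau>) \<le> \<kappa> * L * \<omega> (exp u) + D * real k + 2 * \<kappa> * L"
        by (simp add: D_def algebra_simps)
      show ?thesis using 1 2 3 4 5 6 r unfolding A_def by linarith
    qed
    have "(1 + \<bar>x\<bar>) ^ q = exp (real q * \<tau>)"
      by (simp add: exp_of_nat_mult \<tau>)
    then have "p_term \<omega> \<kappa> (\<lambda>x. f (x + real k)) i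
        = exp (real q * \<tau> - \<kappa> * ?Y (real (n + q) / \<kappa>)) * ?N"
      by (simp add: i p_term_def nth_derivative_shift y_def exp_diff exp_minus divide_inverse mult_ac)
    also have "\<dots> \<le> exp (real q * \<tau> - \<kappa> * ?Y (real (n + q) / \<kappa>)) * (?P * exp (e - real r * u))"
      using N by (intro mult_left_mono) auto
    also have "\<dots> = ?P * exp (real q * \<tau> - \<kappa> * ?Y (real (n + q) / \<kappa>) + (e - real r * u))"
      unfolding exp_add by (simp only: mult_ac)
    also have "\<dots> \<le> ?P * exp (real k * (A + D))"
    proof (rule mult_left_mono)
      \<comment> \<open>As \<open>k >= 1\<close>, the constant \<open>A\<close> is absorbed into
        \<open>A * k\<close>, which leaves a pure \<open>k\<close>-th power.\<close>
      have "A * 1 \<le> A * real k" using AD k by (intro mult_left_mono) auto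
      then show "exp (real q * \<tau> - \<kappa> * ?Y (real (n + q) / \<kappa>) + (e - real r * u)) \<le> exp (real k * (A + D))"
        using exponent by (simp add: algebra_simps)
      show "0 \<le> ?P" using p_seminorm_nonneg[OF f] \<nu> by simp
    qed
    also have "\<dots> = exp (A + D) ^ k * ?P" by (simp add: exp_of_nat_mult)
    finally show "p_term \<omega> \<kappa> (\<lambda>x. f (x + real k)) i \<le> exp (A + D) ^ k * ?P" .
  qed
qed

lemma funpow_composition_operator_shift:
  "(composition_operator (\<lambda>x :: real. x + 1) ^^ k) f = (\<lambda>x. f (x + real k))"
  by (induction k) (simp_all add: composition_operator_def o_def add_ac)

theorem proposition3p2:
  fixes \<omega> :: "real \<Rightarrow> real" and \<psi> :: "real \<Rightarrow> real"
  assumes "weight_function \<omega>"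
    and "\<psi> = (\<lambda>x. x + 1)"
  shows "m_topologizable (S_space \<omega>) (S_seminorms \<omega>) (composition_operator \<psi>)"
proof -
  let ?E = "S_space \<omega>" and ?P = "S_seminorms \<omega>" and ?T = "composition_operator \<psi>"
  note \<omega> = assms(1)
  have T: "?T f = (\<lambda>x. f (x + 1))" for f :: "real \<Rightarrow> complex"
    by (simp add: assms(2) composition_operator_def o_def)
  have powers: "\<exists>q\<in>?P. \<exists>C\<ge>1. \<forall>k\<ge>1. \<forall>f\<in>?E. p ((?T ^^ k) f) \<le> C ^ k * q f" if "p \<in> ?P" for p
  proof -
    obtain \<kappa> where \<kappa>: "p = p_seminorm \<omega> \<kappa>" "\<kappa> > 0"
      using \<open>p \<in> ?P\<close> unfolding S_seminorms_def by blast
    obtain \<mu> C where C: "\<mu> > 0" "C \<ge> 1"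
      "\<And>k f i. k \<ge> 1 \<Longrightarrow> f \<in> ?E \<Longrightarrow>
        p_term \<omega> \<kappa> (\<lambda>x. f (x + real k)) i \<le> C ^ k * p_seminorm \<omega> \<mu> f"
      using p_term_translation_bound[OF \<omega> \<kappa>(2)] by blast
    have "p ((?T ^^ k) f) \<le> C ^ k * p_seminorm \<omega> \<mu> f" if "k \<ge> 1" "f \<in> ?E" for k f
      unfolding \<kappa> assms(2) funpow_composition_operator_shift
      by (rule p_seminorm_le) (rule C(3)[OF that])
    moreover have "p_seminorm \<omega> \<mu> \<in> ?P" using C unfolding S_seminorms_def by blast
    ultimately show ?thesis using C(2) by blast
  qed
  have TE: "?T \<in> ?E \<rightarrow> ?E"
  proof
    fix f assume f: "f \<in> ?E"
    show "?T f \<in> ?E"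
      unfolding T
    \<comment> \<open>Membership requires the terms themselves to be bounded; this is the
      translation bound for \<open>k = 1\<close>.\<close>
    proof (rule S_space_memI[OF smooth_shift[OF S_space_smooth[OF f]]])
      fix \<kappa> :: real assume "\<kappa> > 0"
      then obtain \<mu> C where C: "\<mu> > 0" "C \<ge> 1"
        "\<And>k f i. k \<ge> 1 \<Longrightarrow> f \<in> ?E \<Longrightarrow>
          p_term \<omega> \<kappa> (\<lambda>x. f (x + real k)) i \<le> C ^ k * p_seminorm \<omega> \<mu> f"
        using p_term_translation_bound[OF \<omega>] by metis
      show "\<exists>C. \<forall>i. p_term \<omega> \<kappa> (\<lambda>x. f (x + 1)) i \<le> C"
        using C(3)[of 1, OF _ f] by auto
    qed
  qed
  have "continuous_map (seminorm_topology ?E ?P) (seminorm_topology ?E ?P) ?T"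
  proof (rule continuous_map_seminorm_topology)
    show "function_subspace ?E" by (rule function_subspace_S_space)
    show "seminorm_on ?E p" if "p \<in> ?P" for p
      using that seminorm_on_p_seminorm unfolding S_seminorms_def by blast
    show "?T (\<lambda>x. f x - g x) = (\<lambda>x. ?T f x - ?T g x)" for f g
      by (simp add: T)
    show "\<exists>q\<in>?P. \<exists>C>0. \<forall>f\<in>?E. p (?T f) \<le> C * q f" if p: "p \<in> ?P" for p
    proof -
      \<comment> \<open>Continuity is the case \<open>k = 1\<close> of the estimate for
        powers.\<close>
      obtain q C where q: "q \<in> ?P" "C \<ge> 1"
        "\<forall>k\<ge>1. \<forall>f\<in>?E. p ((?T ^^ k) f) \<le> C ^ k * q f"
        using powers[OF p] by blast
      have "C > 0" using q(2) by simp
      moreover have "\<forall>f\<in>?E. p (?T f) \<le> C * q f"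
        using q(3)[rule_format, of 1] by simp
      ultimately show ?thesis using q(1) by blast
    qed
  qed (rule TE)
  then have "continuous_linear_operator ?E ?P ?T"
    unfolding continuous_linear_operator_def using TE by (simp add: T)
  then show ?thesis
    unfolding m_topologizable_def using locally_convex_Hausdorff_S_space powers by blast
qed

end
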